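(* Every weakly claw-free finite simple graph is Z-insensitive.
   Context: Graphs are finite and simple. $N(v)$ and $N[v]=N(v)\cup\{v\}$ denote the open and closed neighborhood of a vertex $v$, and $N[D]=\bigcup_{v\in D}N[v]$ for $D\subseteq V(G)$. A vertex $w$ is the center of a claw if $w$ has three pairwise non-adjacent neighbors (i.e. $w$ is the degree-$3$ vertex of an induced $K_{1,3}$). A graph $G$ is weakly claw-free if every vertex $u\in V(G)$ has a neighbor that is not the center of a claw (in particular, $G$ has no isolated vertices). For $A\subseteq V(G)$, let $G|A$ denote the partially dominated graph in which the vertices of $A$ are considered already dominated. $G|A$ has a Z-configuration if there is a vertex $v\in V(G)\setminus A$ such that $N(v)\subseteq A$ and $|N(u)\setminus A|\ge 2$ for each $u\in N(v)$. A graph $G$ without isolated vertices is Z-insensitive if for every $D\subseteq V(G)$ the partially dominated graph $G|N[D]$ has no Z-configuration. *)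

theory Defs
  imports "Graph_Theory.Digraph"
begin

text \<open>
  Finite simple graphs are the locale \<^term>\<open>graph\<close>: finite, loop-free symmetric digraphs without
  parallel arcs. Two vertices are adjacent iff \<^term>\<open>u \<rightarrow>\<^bsub>G\<^esub> v\<close>.
\<close>

definition neighborhood :: "('a, 'b) pre_digraph \<Rightarrow> 'a \<Rightarrow> 'a set" where
  "neighborhood G v = {w \<in> verts G. v \<rightarrow>\<^bsub>G\<^esub> w}"

definition closed_neighborhood :: "('a, 'b) pre_digraph \<Rightarrow> 'a \<Rightarrow> 'a set" where
  "closed_neighborhood G v = neighborhood G v \<union> {v}"

definition closed_neighborhood_set :: "('a, 'b) pre_digraph \<Rightarrow> 'a set \<Rightarrow> 'a set" where
  "closed_neighborhood_set G D = (\<Union>v\<in>D. closed_neighborhood G v)"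

definition claw_center :: "('a, 'b) pre_digraph \<Rightarrow> 'a \<Rightarrow> bool" where
  "claw_center G w \<longleftrightarrow>
     (\<exists>x \<in> neighborhood G w. \<exists>y \<in> neighborhood G w. \<exists>z \<in> neighborhood G w.
        x \<noteq> y \<and> x \<noteq> z \<and> y \<noteq> z \<and>
        \<not> x \<rightarrow>\<^bsub>G\<^esub> y \<and> \<not> x \<rightarrow>\<^bsub>G\<^esub> z \<and> \<not> y \<rightarrow>\<^bsub>G\<^esub> z)"

definition weakly_claw_free :: "('a, 'b) pre_digraph \<Rightarrow> bool" where
  "weakly_claw_free G \<longleftrightarrow> (\<forall>u \<in> verts G. \<exists>w \<in> neighborhood G u. \<not> claw_center G w)"

definition no_isolated_vertices :: "('a, 'b) pre_digraph \<Rightarrow> bool" where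
  "no_isolated_vertices G \<longleftrightarrow> (\<forall>v \<in> verts G. neighborhood G v \<noteq> {})"

text \<open>The partially dominated graph $G|A$ is given by its two components \<open>G\<close> and \<open>A\<close>.\<close>

definition has_Z_configuration :: "('a, 'b) pre_digraph \<Rightarrow> 'a set \<Rightarrow> bool" where
  "has_Z_configuration G A \<longleftrightarrow>
     (\<exists>v \<in> verts G - A. neighborhood G v \<subseteq> A \<and>
        (\<forall>u \<in> neighborhood G v. card (neighborhood G u - A) \<ge> 2))"

definition Z_insensitive :: "('a, 'b) pre_digraph \<Rightarrow> bool" where
  "Z_insensitive G \<longleftrightarrow> no_isolated_vertices G \<and>
     (\<forall>D. D \<subseteq> verts G \<longrightarrow> \<not> has_Z_configuration G (closed_neighborhood_set G D))"

end

(* Let v, A = N[D] be a Z-configuration and u a neighbor of v that is not the center of a claw.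
   Since v is undominated, u is not in D, so u has a neighbor d in D. Besides v, u has a
   second undominated neighbor x. Undominated vertices are not adjacent to d, and v has only
   dominated neighbors, so u is the center of a claw with leaves v, x, d. *)
theory Submission
  imports Defs
begin

lemma (in sym_digraph) neighborhood_iff_adj:
  "w \<in> neighborhood G v \<longleftrightarrow> v \<rightarrow>\<^bsub>G\<^esub> w"
  unfolding neighborhood_def using adj_in_verts(2) by blast

lemma (in sym_digraph) neighborhood_sym:
  assumes "w \<in> neighborhood G v"
  shows "v \<in> neighborhood G w"
  using assms arcs_ends_symmetric[OF sym_arcs] unfolding neighborhood_iff_adj by blast

text \<open>Since \<open>u\<close> is arbitrary here, this contradicts weak claw-freeness at
  \<open>v\<close>, which promises a neighbor that is not a claw center.\<close>

lemma (in sym_digraph) Z_configuration_neighbors_claw_centers: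
  assumes v: "v \<in> verts G - closed_neighborhood_set G D"
    and dominated: "neighborhood G v \<subseteq> closed_neighborhood_set G D"
    and u: "u \<in> neighborhood G v"
    and two: "card (neighborhood G u - closed_neighborhood_set G D) \<ge> 2"
  shows "claw_center G u"
proof -
  let ?A = "closed_neighborhood_set G D"
  have vu: "v \<in> neighborhood G u"
    using u by (rule neighborhood_sym)
  \<comment> \<open>Otherwise \<open>v\<close>, as a neighbor of \<open>u\<close>, would be
    dominated.\<close>
  have "u \<notin> D"
    using v vu by (auto simp: closed_neighborhood_set_def closed_neighborhood_def)
  moreover have "u \<in> ?A"
    using u dominated by blast
  ultimately obtain d where d: "d \<in> D" "u \<in> neighborhood G d"
    by (auto simp: closed_neighborhood_set_def closed_neighborhood_def)
  \<comment> \<open>A subset of a singleton has at most one element.\<close>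
  have "\<not> neighborhood G u - ?A \<subseteq> {v}"
    using two card_mono[of "{v}" "neighborhood G u - ?A"] by auto
  then obtain x where x: "x \<in> neighborhood G u" "x \<notin> ?A" "x \<noteq> v"
    by blast
  \<comment> \<open>As \<open>d\<close> lies in \<open>D\<close>, its whole closed neighborhood is
    dominated; symmetry reverses the arc.\<close>
  have undominated: "\<not> w \<rightarrow>\<^bsub>G\<^esub> d \<and> w \<noteq> d" if "w \<notin> ?A" for w
  proof -
    have "w \<notin> neighborhood G d" "w \<noteq> d"
      using that d(1) by (auto simp: closed_neighborhood_set_def closed_neighborhood_def)
    then show ?thesis
      using neighborhood_sym unfolding neighborhood_iff_adj by blast
  qed
  have "\<not> v \<rightarrow>\<^bsub>G\<^esub> x"
    using x(2) dominated unfolding neighborhood_iff_adj[symmetric] by blast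
  moreover have "d \<in> neighborhood G u"
    using d(2) by (rule neighborhood_sym)
  moreover have "\<not> v \<rightarrow>\<^bsub>G\<^esub> d \<and> v \<noteq> d" "\<not> x \<rightarrow>\<^bsub>G\<^esub> d \<and> x \<noteq> d"
    by (rule undominated, use v x(2) in blast)+
  \<comment> \<open>\<open>claw_center\<close> tests each pair of leaves in one direction; the order
    \<open>v\<close>, \<open>x\<close>, \<open>d\<close> matches the arcs excluded above.\<close>
  ultimately show ?thesis
    unfolding claw_center_def
    by (intro bexI[OF _ vu] bexI[OF _ x(1)] bexI[of _ d]) (use x(3) in blast)+
qed

theorem mainTheorem5:
  fixes G :: "('a, 'b) pre_digraph"
  assumes "graph G"
    and "weakly_claw_free G"
  shows "Z_insensitive G"
proof -
  interpret graph G by fact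
  have "\<not> has_Z_configuration G (closed_neighborhood_set G D)" for D
  proof
    assume "has_Z_configuration G (closed_neighborhood_set G D)"
    then obtain v where v: "v \<in> verts G - closed_neighborhood_set G D"
        "neighborhood G v \<subseteq> closed_neighborhood_set G D"
        "\<forall>u \<in> neighborhood G v. card (neighborhood G u - closed_neighborhood_set G D) \<ge> 2"
      by (auto simp: has_Z_configuration_def)
    \<comment> \<open>Weak claw-freeness is applied at the undominated vertex \<open>v\<close>
      itself.\<close>
    obtain u where "u \<in> neighborhood G v" "\<not> claw_center G u"
      using assms(2) v(1) by (auto simp: weakly_claw_free_def)
    with v show False
      using Z_configuration_neighbors_claw_centers by blast
  qed
  moreover have "no_isolated_vertices G"
    using assms(2) by (auto simp: weakly_claw_free_def no_isolated_vertices_def)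
  ultimately show ?thesis
    by (simp add: Z_insensitive_def)
qed

end
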